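(* Let $d,m\in\mathbb{N}$, let $a_1,\ldots,a_m$ be distinct points of $\mathbb{R}^d$, and let $F\subset\mathbb{R}^d$ be a nonempty compact convex set with $0\in\operatorname{int}(F)$. Let $i_0\in\{1,\ldots,m\}$ be arbitrary and put $\rho=\max_{1\le i\le m}\rho_F(a_{i_0}-a_i)$. Then the global optimal solution set $S_1^F$ of the problem $$\min\Big\{f_1^F(x)=\max_{1\le i\le m}\rho_F(x-a_i)\ \Big|\ x\in\mathbb{R}^d\Big\}$$ is a nonempty compact convex subset of $\mathbb{B}_F[a_{i_0},\rho]$.
   Context: The Minkowski gauge function $\rho_F:\mathbb{R}^d\to[0,\infty)$ of $F$ is $\rho_F(x)=\inf\{t\ge 0\mid x\in tF\}$. For $\gamma\ge 0$ and $a\in\mathbb{R}^d$, $\mathbb{B}_F[a,\gamma]=\{y\in\mathbb{R}^d\mid \rho_F(y-a)\le\gamma\}$. $S_1^F$ is the set of all global minimizers of $f_1^F$ over $\mathbb{R}^d$. *)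

theory Defs
  imports "HOL-Analysis.Analysis"
begin

text \<open>
  The infimum is taken in the reals, so the definition has its intended meaning only where some
  \<open>t \<ge> 0\<close> satisfies \<open>x \<in> tF\<close>; this holds for every \<open>x\<close> when \<open>0\<close> is interior to \<open>F\<close>.
\<close>

definition minkowski_gauge :: "(real ^ 'd) set \<Rightarrow> real ^ 'd \<Rightarrow> real" where
  "minkowski_gauge F x = Inf {t. 0 \<le> t \<and> x \<in> (\<lambda>y. t *\<^sub>R y) ` F}"

definition gauge_ball :: "(real ^ 'd) set \<Rightarrow> real ^ 'd \<Rightarrow> real \<Rightarrow> (real ^ 'd) set" where
  "gauge_ball F a \<gamma> = {y. minkowski_gauge F (y - a) \<le> \<gamma>}"

text \<open>The points are indexed by \<open>{1..m}\<close>; the maximum below is meaningful for \<open>m \<ge> 1\<close>.\<close>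

definition max_gauge_objective ::
  "(real ^ 'd) set \<Rightarrow> nat \<Rightarrow> (nat \<Rightarrow> real ^ 'd) \<Rightarrow> real ^ 'd \<Rightarrow> real" where
  "max_gauge_objective F m a x = (MAX i\<in>{1..m}. minkowski_gauge F (x - a i))"

definition optimal_set :: "(real ^ 'd) set \<Rightarrow> nat \<Rightarrow> (nat \<Rightarrow> real ^ 'd) \<Rightarrow> (real ^ 'd) set" where
  "optimal_set F m a =
    {x. \<forall>y. max_gauge_objective F m a x \<le> max_gauge_objective F m a y}"

end

theory Submission
  imports Defs
begin

text \<open>
  The infimum defining the gauge is attained, so the sublevel set of \<open>f\<close> at height \<open>t \<ge> 0\<close> is the
  intersection of the translates \<open>a i + tF\<close>, which is compact and convex. Nested nonempty compact
  sublevel sets have a common point, so the infimum of \<open>f\<close> is attained, and the solution set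
  is itself a sublevel set. A minimizer \<open>x\<close> satisfies
  \<open>\<rho>\<^sub>F (x - a i0) \<le> f x \<le> f (a i0) = \<rho>\<close>.
\<close>

locale gauge_body =
  fixes F :: "(real ^ 'd) set"
  assumes compact: "compact F" and convex: "convex F" and zero_interior: "0 \<in> interior F"
begin

lemma zero_mem: "0 \<in> F"
  using zero_interior interior_subset by blast

text \<open>Some ball about 0 lies in \<open>F\<close>, and shrinking brings any vector into it.
  Hence the infimum defining the gauge is over a nonempty set.\<close>

lemma absorbing: "\<exists>t\<ge>0. x \<in> (*\<^sub>R) t ` F"
proof -
  obtain r where r: "r > 0" "cball 0 r \<subseteq> F"
    using zero_interior by (auto simp: mem_interior_cball)
  \<comment> \<open>The summand 1 keeps \<open>t\<close> positive when \<open>x = 0\<close>.\<close>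
  define t where "t = norm x / r + 1"
  have t: "t > 0" using r by (simp add: t_def add_nonneg_pos)
  have "norm x \<le> r * t" using r by (simp add: t_def field_simps)
  then have "(1 / t) *\<^sub>R x \<in> F"
    using r t by (intro subsetD[OF r(2)]) (simp add: field_simps)
  then have "x \<in> (*\<^sub>R) t ` F"
    using t by (intro image_eqI[of _ _ "(1 / t) *\<^sub>R x"]) auto
  then show ?thesis using t by (meson less_imp_le)
qed

text \<open>A convex set containing 0 is star-shaped about 0, so \<open>(s / t) *\<^sub>R y\<close>
  stays in \<open>F\<close>.\<close>

lemma scale_mono:
  assumes "0 \<le> s" "s \<le> t" "x \<in> (*\<^sub>R) s ` F"
  shows "x \<in> (*\<^sub>R) t ` F"
proof (cases "t = 0")
  case False
  then have t: "t > 0" using assms by simp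
  obtain y where y: "y \<in> F" "x = s *\<^sub>R y" using assms by blast
  have "(s / t) *\<^sub>R y + (1 - s / t) *\<^sub>R 0 \<in> F"
    using assms t y by (intro convexD[OF convex _ zero_mem]) auto
  then show ?thesis
    using t y by (intro image_eqI[of _ _ "(s / t) *\<^sub>R y"]) auto
qed (use assms in auto)

lemma gauge_nonneg: "0 \<le> minkowski_gauge F x"
  unfolding minkowski_gauge_def using absorbing[of x] by (intro cInf_greatest) auto

text \<open>The admissible factors are the projection of a closed set of pairs along the compact
  factor \<open>F\<close>, cut down to \<open>t \<ge> 0\<close>. They form a closed set, which
  therefore contains its infimum.\<close>

lemma gauge_attained: "x \<in> (*\<^sub>R) (minkowski_gauge F x) ` F"
proof -
  let ?T = "{t. 0 \<le> t \<and> x \<in> (*\<^sub>R) t ` F}"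
  have "closed {p :: (real ^ 'd) \<times> real. x = snd p *\<^sub>R fst p}"
    by (intro closed_Collect_eq continuous_intros)
  from closed_compact_projection[OF compact this]
  have "closed {t. x \<in> (*\<^sub>R) t ` F}"
    by (simp add: image_iff Bex_def)
  then have "closed ?T"
    by (intro closed_Collect_conj closed_Collect_le continuous_intros)
  moreover have "?T \<noteq> {}" "bdd_below ?T"
    using absorbing[of x] by (auto intro: bdd_belowI[of _ 0])
  ultimately have "Inf ?T \<in> ?T"
    by (intro closed_contains_Inf)
  then show ?thesis by (simp add: minkowski_gauge_def)
qed

text \<open>Attainment covers the boundary case where \<open>t\<close> equals the gauge;
  \<open>scale_mono\<close> passes to larger \<open>t\<close>.\<close>

lemma gauge_le_iff:
  assumes "0 \<le> t"
  shows "minkowski_gauge F x \<le> t \<longleftrightarrow> x \<in> (*\<^sub>R) t ` F"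
proof
  assume "minkowski_gauge F x \<le> t"
  then show "x \<in> (*\<^sub>R) t ` F"
    using scale_mono gauge_nonneg gauge_attained by blast
next
  assume "x \<in> (*\<^sub>R) t ` F"
  then show "minkowski_gauge F x \<le> t"
    unfolding minkowski_gauge_def using assms
    by (intro cInf_lower) (auto intro: bdd_belowI[of _ 0])
qed

text \<open>As images of \<open>F\<close> under scaling and translation, gauge balls inherit
  compactness and convexity.\<close>

lemma gauge_ball_eq:
  assumes "0 \<le> t"
  shows "gauge_ball F c t = (+) c ` (*\<^sub>R) t ` F"
proof -
  have "y - c \<in> (*\<^sub>R) t ` F \<longleftrightarrow> y \<in> (+) c ` (*\<^sub>R) t ` F" for y
    by (force simp: image_iff algebra_simps)
  then show ?thesis
    using assms by (simp add: gauge_ball_def gauge_le_iff)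
qed

lemma compact_gauge_ball: "0 \<le> t \<Longrightarrow> compact (gauge_ball F c t)"
  by (simp add: gauge_ball_eq compact compact_scaling compact_translation)

lemma convex_gauge_ball: "0 \<le> t \<Longrightarrow> convex (gauge_ball F c t)"
  by (simp add: gauge_ball_eq convex convex_scaling convex_translation)

lemma objective_le_iff:
  assumes "m \<ge> 1"
  shows "max_gauge_objective F m a x \<le> t \<longleftrightarrow> (\<forall>i\<in>{1..m}. minkowski_gauge F (x - a i) \<le> t)"
  using assms by (simp add: max_gauge_objective_def)

lemma objective_nonneg:
  assumes "m \<ge> 1"
  shows "0 \<le> max_gauge_objective F m a x"
proof -
  have "minkowski_gauge F (x - a 1) \<le> max_gauge_objective F m a x"
    using objective_le_iff[OF assms, of a x "max_gauge_objective F m a x"] assms by simp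
  then show ?thesis using gauge_nonneg order_trans by blast
qed

lemma sublevel_eq:
  assumes "m \<ge> 1"
  shows "{x. max_gauge_objective F m a x \<le> t} = (\<Inter>i\<in>{1..m}. gauge_ball F (a i) t)"
  by (auto simp: objective_le_iff[OF assms] gauge_ball_def)

lemma compact_sublevel:
  assumes "m \<ge> 1" "0 \<le> t"
  shows "compact {x. max_gauge_objective F m a x \<le> t}"
  unfolding sublevel_eq[OF assms(1)] using assms
  by (intro compact_Inter) (auto intro: compact_gauge_ball)

lemma convex_sublevel:
  assumes "m \<ge> 1" "0 \<le> t"
  shows "convex {x. max_gauge_objective F m a x \<le> t}"
  unfolding sublevel_eq[OF assms(1)] using assms
  by (intro convex_INT convex_gauge_ball)

lemma optimal_set_nonempty:
  assumes m: "m \<ge> 1"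
  shows "optimal_set F m a \<noteq> {}"
proof -
  let ?f = "max_gauge_objective F m a"
  define v where "v = (INF x. ?f x)"
  \<comment> \<open>Heights strictly above \<open>v\<close> make each level set nonempty by
    definition of the infimum, and they decrease to \<open>v\<close>.\<close>
  define L where "L n = {x. ?f x \<le> v + 1 / real (Suc n)}" for n
  have bdd: "bdd_below (range ?f)"
    using objective_nonneg[OF m] by (auto intro: bdd_belowI[of _ 0])
  have v_le: "v \<le> ?f x" for x
    unfolding v_def using bdd by (intro cINF_lower) auto
  \<comment> \<open>Keeps all heights nonnegative, as \<open>compact_sublevel\<close>
    requires.\<close>
  have "0 \<le> v"
    unfolding v_def using objective_nonneg[OF m] by (intro cINF_greatest) auto
  then have "compact (L n)" for n
    unfolding L_def by (intro compact_sublevel[OF m]) simp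
  moreover have "L n \<noteq> {}" for n
  proof -
    have "(INF x. ?f x) < v + 1 / real (Suc n)" by (simp add: v_def)
    then obtain x where "?f x < v + 1 / real (Suc n)"
      using bdd by (subst (asm) cINF_less_iff) auto
    then show ?thesis by (auto simp: L_def intro: less_imp_le)
  qed
  moreover have "L n' \<subseteq> L n" if "n \<le> n'" for n n'
  proof -
    have "1 / real (Suc n') \<le> 1 / real (Suc n)" using that by (simp add: frac_le)
    then show ?thesis by (auto simp: L_def)
  qed
  ultimately have "\<Inter> (range L) \<noteq> {}" by (rule compact_nest)
  then obtain x where x: "?f x \<le> v + 1 / real (Suc n)" for n
    by (auto simp: L_def)
  have "(\<lambda>n. v + 1 / real (Suc n)) \<longlonglongrightarrow> v + 0"
    by (intro tendsto_intros LIMSEQ_Suc lim_1_over_n)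
  then have "?f x \<le> v"
    using x by (intro LIMSEQ_le_const) auto
  then have "x \<in> optimal_set F m a"
    using v_le by (auto simp: optimal_set_def intro: order_trans)
  then show ?thesis by blast
qed

text \<open>The height is the minimum value, so compactness and convexity of sublevel sets carry
  over to the solution set.\<close>

lemma optimal_set_eq_sublevel:
  assumes "x \<in> optimal_set F m a"
  shows "optimal_set F m a = {y. max_gauge_objective F m a y \<le> max_gauge_objective F m a x}"
  using assms by (auto simp: optimal_set_def intro: order_trans)

end

theorem theorem2p4:
  fixes F :: "(real ^ 'd) set" and a :: "nat \<Rightarrow> real ^ 'd" and m i0 :: nat and \<rho> :: real
  assumes "inj_on a {1..m}"
    and "F \<noteq> {}" and "compact F" and "convex F" and "0 \<in> interior F"
    and "i0 \<in> {1..m}"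
    and "\<rho> = (MAX i\<in>{1..m}. minkowski_gauge F (a i0 - a i))"
  shows "optimal_set F m a \<noteq> {} \<and> compact (optimal_set F m a) \<and> convex (optimal_set F m a)
    \<and> optimal_set F m a \<subseteq> gauge_ball F (a i0) \<rho>"
proof -
  interpret gauge_body F
    using assms by unfold_locales
  have m: "m \<ge> 1" using assms(6) by simp
  obtain x where x: "x \<in> optimal_set F m a"
    using optimal_set_nonempty[OF m] by blast
  note eq = optimal_set_eq_sublevel[OF x]
  have "compact (optimal_set F m a)" "convex (optimal_set F m a)"
    unfolding eq using compact_sublevel convex_sublevel objective_nonneg m by blast+
  moreover have "optimal_set F m a \<subseteq> gauge_ball F (a i0) \<rho>"
  proof
    fix y assume "y \<in> optimal_set F m a"
    \<comment> \<open>The competitor is \<open>a i0\<close>, whose objective value is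
      \<rho>.\<close>
    then have "max_gauge_objective F m a y \<le> \<rho>"
      using assms(7) by (simp add: optimal_set_def max_gauge_objective_def)
    then show "y \<in> gauge_ball F (a i0) \<rho>"
      using assms(6) by (simp add: objective_le_iff[OF m] gauge_ball_def)
  qed
  ultimately show ?thesis using x by blast
qed

end
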